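(* Suppose that in the economy without a ban the probability of a buy order and the probability of a sell order are both less than $1/2$ (this holds, e.g., if $g<1/2$). Then when a short-selling ban is implemented the mean price remains unchanged, $\mathbb{E}[\tilde q]=\mathbb{E}[q]$, while the median price decreases: the median of $\tilde q$ is strictly smaller than the median of $q$.
   Context: Parameters: $p,\alpha,g\in(0,1)$, $h_I\in(0,1)$, $h_N\in(0,1]$. The asset value $V$ is Bernoulli with $P(V=1)=p$, $P(V=0)=1-p$. A random variable $\eta_s\in[0,1]$, independent of $V$, has probability density $f$ on $[0,1]$; it is known to the market maker. One trader arrives. With probability $1-g$ he is inactive (no trade). With probability $g$ he is active; an active trader is informed with probability $\alpha$ and noise with probability $1-\alpha$. An active informed trader buys if $V=1$ and wants to sell if $V=0$. An active noise trader wants to sell with probability $\eta_s$ and buys with probability $1-\eta_s$, independently of $V$. An informed (resp. noise) trader owns the stock with probability $h_I$ (resp. $h_N$), independently of everything else. Without a ban, every trader who wants to sell does so (shorting if he does not own the stock). With a ban, a trader who wants to sell but does not own the stock does not trade (no trade is observed); buying is unaffected. The price is the market maker's expectation of $V$ given $\eta_s$ and the observed action. Without a ban, the price $q$ given $\eta_s$ equals: $Bid=\frac{(1-\alpha)\eta_s p}{(1-\alpha)\eta_s+\alpha(1-p)}$ with probability $P(Sell\mid\eta_s)=g(1-\alpha)\eta_s+g\alpha(1-p)$; $Ask=\frac{(1-\alpha)(1-\eta_s)p+\alpha p}{(1-\alpha)(1-\eta_s)+\alpha p}$ with probability $P(Buy\mid\eta_s)=g(1-\alpha)(1-\eta_s)+g\alpha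 p$; and $p$ with probability $1-g$. The probabilities of a buy order and of a sell order are $P(Buy)=\mathbb{E}[P(Buy\mid\eta_s)]$ and $P(Sell)=\mathbb{E}[P(Sell\mid\eta_s)]$. With a ban, the price $\tilde q$ given $\eta_s$ equals: $\widetilde{Bid}=\frac{(1-\alpha)h_N\eta_s p}{\alpha h_I(1-p)+(1-\alpha)h_N\eta_s}$ with probability $g(1-\alpha)h_N\eta_s+g\alpha h_I(1-p)$; $\widetilde{Ask}=Ask$ with probability $g(1-\alpha)(1-\eta_s)+g\alpha p$; and the no-trade price $\frac{((1-g)+g(1-\alpha)\eta_s(1-h_N))p}{1-g+g((1-\alpha)\eta_s(1-h_N)+\alpha(1-p)(1-h_I))}$ with the remaining probability. The laws of $q$ and $\tilde q$ are those under the joint law of $\eta_s\sim f$ and the action. A median of a random variable $X$ is any $m$ with $P(X\le m)\ge 1/2$ and $P(X\ge m)\ge 1/2$; the median comparison means that every median of $\tilde q$ is strictly less than every median of $q$. *)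

theory Defs
  imports "HOL-Probability.Probability"
begin

datatype action = Buy | Sell | No_Trade

text \<open>
  Everything random except \<open>\<eta>\<^sub>s\<close>: is the asset value 1, is the trader active, informed, does he want
  to sell (as opposed to buy), does he own the stock. The last three components are also drawn
  for an inactive trader, but are then irrelevant.
\<close>

type_synonym draw = "bool \<times> bool \<times> bool \<times> bool \<times> bool"

definition draw_pmf ::
  "real \<Rightarrow> real \<Rightarrow> real \<Rightarrow> real \<Rightarrow> real \<Rightarrow> real \<Rightarrow> draw pmf" where
  "draw_pmf p \<alpha> g h\<^sub>I h\<^sub>N \<eta> =
     do {
       high \<leftarrow> bernoulli_pmf p;
       active \<leftarrow> bernoulli_pmf g;
       informed \<leftarrow> bernoulli_pmf \<alpha>;
       sells \<leftarrow> (if informed then return_pmf (\<not> high) else bernoulli_pmf \<eta>);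
       owns \<leftarrow> bernoulli_pmf (if informed then h\<^sub>I else h\<^sub>N);
       return_pmf (high, active, informed, sells, owns)
     }"

text \<open>
  The joint law of \<open>(\<eta>\<^sub>s, draw)\<close>: \<open>\<eta>\<^sub>s\<close> has Lebesgue density \<open>f\<close> and,
  given \<open>\<eta>\<^sub>s = \<eta>\<close>, the draw has law \<open>draw_pmf p \<alpha> g h\<^sub>I h\<^sub>N \<eta>\<close>.
\<close>

definition economy ::
  "real \<Rightarrow> real \<Rightarrow> real \<Rightarrow> real \<Rightarrow> real \<Rightarrow> (real \<Rightarrow> real) \<Rightarrow> (real \<times> draw) measure" where
  "economy p \<alpha> g h\<^sub>I h\<^sub>N f =
     density (lborel \<Otimes>\<^sub>M count_space UNIV)
       (\<lambda>(\<eta>, d). ennreal (f \<eta> * pmf (draw_pmf p \<alpha> g h\<^sub>I h\<^sub>N \<eta>) d))"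

fun asset_value :: "real \<times> draw \<Rightarrow> real" where
  "asset_value (\<eta>, high, active, informed, sells, owns) = of_bool high"

fun observed_action :: "bool \<Rightarrow> real \<times> draw \<Rightarrow> action" where
  "observed_action ban (\<eta>, high, active, informed, sells, owns) =
     (if \<not> active then No_Trade
      else if \<not> sells then Buy
      else if ban \<and> \<not> owns then No_Trade
      else Sell)"

text \<open>
  The market maker's information is the \<open>\<sigma>\<close>-algebra generated by \<open>\<eta>\<^sub>s\<close> and the observed action.
\<close>

definition market_info :: "bool \<Rightarrow> (real \<times> draw) measure" where
  "market_info ban =
     vimage_algebra UNIV (\<lambda>\<omega>. (fst \<omega>, observed_action ban \<omega>)) (borel \<Otimes>\<^sub>M count_space UNIV)"

definition price :: "(real \<times> draw) measure \<Rightarrow> bool \<Rightarrow> real \<times> draw \<Rightarrow> real" where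
  "price M ban = real_cond_exp M (market_info ban) asset_value"

definition is_median :: "'a measure \<Rightarrow> ('a \<Rightarrow> real) \<Rightarrow> real \<Rightarrow> bool" where
  "is_median M X m \<longleftrightarrow>
     \<P>(\<omega> in M. X \<omega> \<le> m) \<ge> 1 / 2 \<and> \<P>(\<omega> in M. X \<omega> \<ge> m) \<ge> 1 / 2"

end

theory Submission
  imports Defs
begin

text \<open>
  By Bayes' rule the price after an action exceeds, equals or falls below \<open>p\<close> according to whether
  the action is more, equally or less likely when \<open>V = 1\<close> than when \<open>V = 0\<close>. Without a ban an inactive
  market says nothing about \<open>V\<close>, so the price is below \<open>p\<close> only after a sell order; as this has
  probability less than \<open>1/2\<close>, every median is at least \<open>p\<close>. With a ban the absence of a trade may
  hide an informed seller who does not own the stock (\<open>h\<^sub>I < 1\<close>), so the price is below \<open>p\<close> unless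
  there is a buy order; as this has probability less than \<open>1/2\<close>, every median is below \<open>p\<close>.
  Both means are the expectation of \<open>V\<close> by the tower property.
\<close>

section \<open>Densities on the product with a finite counting space\<close>

text \<open>Since the second factor is finite, the function is a finite sum of slice indicators
  times sections, so measurable sections suffice.\<close>

lemma measurable_pair_count_space_finite:
  fixes u :: "'a \<Rightarrow> 'd::finite \<Rightarrow> real"
  assumes [measurable]: "\<And>d. (\<lambda>x. u x d) \<in> borel_measurable N"
  shows "(\<lambda>(x, d). u x d) \<in> borel_measurable (N \<Otimes>\<^sub>M count_space UNIV)"
proof -
  have "(\<lambda>\<omega>. \<Sum>d\<in>UNIV. of_bool (snd \<omega> = d) * u (fst \<omega>) d) \<in> borel_measurable (N \<Otimes>\<^sub>M count_space UNIV)"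
    by measurable
  also have "(\<lambda>\<omega>. \<Sum>d\<in>UNIV. of_bool (snd \<omega> = d) * u (fst \<omega>) d) = (\<lambda>(x, d). u x d)"
    by (auto simp: fun_eq_iff of_bool_def if_distrib[of "\<lambda>c. c * _"] cong: if_cong)
  finally show ?thesis .
qed

text \<open>Fubini, where the inner integral over the counting measure is a finite sum.
  Integrability of \<open>h\<close> under the density passes to the product of \<open>h\<close> with
  the density, as Fubini requires.\<close>

lemma integral_density_count_space:
  fixes u :: "'a \<Rightarrow> 'd::finite \<Rightarrow> real" and h :: "'a \<times> 'd \<Rightarrow> real"
  assumes "sigma_finite_measure N"
    and u: "\<And>d. (\<lambda>x. u x d) \<in> borel_measurable N" "\<And>x d. 0 \<le> u x d"
    and h: "integrable (density (N \<Otimes>\<^sub>M count_space UNIV) (\<lambda>(x, d). ennreal (u x d))) h"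
  shows "(\<integral>\<omega>. h \<omega> \<partial>density (N \<Otimes>\<^sub>M count_space UNIV) (\<lambda>(x, d). ennreal (u x d)))
    = (\<integral>x. (\<Sum>d\<in>UNIV. u x d * h (x, d)) \<partial>N)"
proof -
  interpret N: sigma_finite_measure N by fact
  interpret C: sigma_finite_measure "count_space (UNIV :: 'd set)"
    by (rule sigma_finite_measure_count_space_finite) simp
  interpret P: pair_sigma_finite N "count_space (UNIV :: 'd set)" ..
  note um = measurable_pair_count_space_finite[OF u(1)]
  have hm: "h \<in> borel_measurable (N \<Otimes>\<^sub>M count_space UNIV)"
    using borel_measurable_integrable[OF h] by simp
  \<comment> \<open>\<open>ennreal\<close> has to stand outermost for the integration rules to
    recognise a real-valued density.\<close>
  have eq: "(\<lambda>(x, d). ennreal (u x d)) = (\<lambda>\<omega>. ennreal (case \<omega> of (x, d) \<Rightarrow> u x d))"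
    by auto
  have int: "integrable (N \<Otimes>\<^sub>M count_space UNIV) (\<lambda>\<omega>. (case \<omega> of (x, d) \<Rightarrow> u x d) * h \<omega>)"
    using h unfolding eq by (subst (asm) integrable_density) (use um hm u in auto)
  have "(\<integral>\<omega>. h \<omega> \<partial>density (N \<Otimes>\<^sub>M count_space UNIV) (\<lambda>(x, d). ennreal (u x d)))
    = (\<integral>\<omega>. (case \<omega> of (x, d) \<Rightarrow> u x d) * h \<omega> \<partial>(N \<Otimes>\<^sub>M count_space UNIV))"
    unfolding eq by (subst integral_density) (use um hm u in auto)
  also have "\<dots> = (\<integral>x. (\<integral>d. u x d * h (x, d) \<partial>count_space UNIV) \<partial>N)"
    using P.integral_fst'[OF int] by simp
  finally show ?thesis by (simp add: lebesgue_integral_count_space_finite)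
qed

lemma emeasure_density_count_space:
  fixes u :: "'a \<Rightarrow> 'd::finite \<Rightarrow> real"
  assumes u: "\<And>d. (\<lambda>x. u x d) \<in> borel_measurable N" "\<And>x d. 0 \<le> u x d"
  shows "emeasure (density (N \<Otimes>\<^sub>M count_space UNIV) (\<lambda>(x, d). ennreal (u x d))) (space N \<times> D)
    = (\<integral>\<^sup>+x. ennreal (\<Sum>d\<in>D. u x d) \<partial>N)"
proof -
  interpret C: sigma_finite_measure "count_space (UNIV :: 'd set)"
    by (rule sigma_finite_measure_count_space_finite) simp
  note [measurable] = measurable_pair_count_space_finite[OF u(1)]
  have eq: "(\<lambda>(x, d). ennreal (u x d)) = (\<lambda>\<omega>. ennreal (case \<omega> of (x, d) \<Rightarrow> u x d))"
    by auto
  have "emeasure (density (N \<Otimes>\<^sub>M count_space UNIV) (\<lambda>(x, d). ennreal (u x d))) (space N \<times> D)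
    = (\<integral>\<^sup>+\<omega>. ennreal (case \<omega> of (x, d) \<Rightarrow> u x d) * indicator (space N \<times> D) \<omega> \<partial>(N \<Otimes>\<^sub>M count_space UNIV))"
    unfolding eq by (rule emeasure_density) auto
  also have "\<dots> = (\<integral>\<^sup>+x. (\<integral>\<^sup>+d. ennreal (u x d) * indicator (space N \<times> D) (x, d) \<partial>count_space UNIV) \<partial>N)"
    by (subst C.nn_integral_fst[symmetric]) auto
  also have "\<dots> = (\<integral>\<^sup>+x. ennreal (\<Sum>d\<in>D. u x d) \<partial>N)"
  proof (rule nn_integral_cong)
    fix x assume "x \<in> space N"
    then have "(\<integral>\<^sup>+d. ennreal (u x d) * indicator (space N \<times> D) (x, d) \<partial>count_space UNIV)
        = (\<Sum>d\<in>UNIV. ennreal (u x d) * indicator D d)"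
      by (simp add: nn_integral_count_space_finite indicator_def)
    also have "\<dots> = (\<Sum>d\<in>D. ennreal (u x d))"
      by (simp add: indicator_def if_distrib sum.If_cases cong: if_cong)
    finally show "(\<integral>\<^sup>+d. ennreal (u x d) * indicator (space N \<times> D) (x, d) \<partial>count_space UNIV)
        = ennreal (\<Sum>d\<in>D. u x d)"
      using u(2) by (simp add: sum_ennreal)
  qed
  finally show ?thesis .
qed

section \<open>Conditional expectation given the first coordinate and a function of the
  second\<close>

text \<open>
  Where the denominator vanishes the quotient is the junk value 0, but only on a null set.
\<close>

lemma real_cond_exp_density_count_space:
  fixes N :: "'a measure" and u :: "'a \<Rightarrow> 'd::finite \<Rightarrow> real" and act :: "'d \<Rightarrow> 'b" and v :: "'d \<Rightarrow> real"
  defines "M \<equiv> density (N \<Otimes>\<^sub>M count_space UNIV) (\<lambda>(x, d). ennreal (u x d))"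
    and "F \<equiv> vimage_algebra (space N \<times> UNIV) (\<lambda>\<omega>. (fst \<omega>, act (snd \<omega>))) (N \<Otimes>\<^sub>M count_space UNIV)"
  assumes "sigma_finite_measure N" and M: "prob_space M"
    and u: "\<And>d. (\<lambda>x. u x d) \<in> borel_measurable N" "\<And>x d. 0 \<le> u x d"
  shows "sigma_finite_subalgebra M F"
    and "AE \<omega> in M. real_cond_exp M F (\<lambda>\<omega>. v (snd \<omega>)) \<omega>
      = (\<Sum>d | act d = act (snd \<omega>). u (fst \<omega>) d * v d) / (\<Sum>d | act d = act (snd \<omega>). u (fst \<omega>) d)"
proof -
  interpret prob_space M by fact
  note [measurable] = u(1)
  have sp: "space M = space N \<times> UNIV" by (simp add: M_def space_pair_measure)
  have sets_M[measurable_cong]: "sets M = sets (N \<Otimes>\<^sub>M count_space UNIV)" by (simp add: M_def)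
  have sets_F: "sets F = {(\<lambda>\<omega>. (fst \<omega>, act (snd \<omega>))) -` B \<inter> (space N \<times> UNIV) | B.
      B \<in> sets (N \<Otimes>\<^sub>M count_space UNIV)}"
    unfolding F_def by (rule sets_vimage_algebra2) (auto simp: space_pair_measure)
  have sub: "subalgebra M F"
    unfolding subalgebra_def F_def
    by (intro conjI sets_image_in_sets) (auto simp: sp)
  interpret finite_measure_subalgebra M F by unfold_locales (rule sub)
  show "sigma_finite_subalgebra M F" ..
  let ?q = "\<lambda>x a. (\<Sum>d | act d = a. u x d * v d) / (\<Sum>d | act d = a. u x d)"
  \<comment> \<open>The quotient depends on \<omega> only through the map that generates
    \<open>F\<close>.\<close>
  have q: "(\<lambda>\<omega>. ?q (fst \<omega>) (act (snd \<omega>))) \<in> borel_measurable F"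
  proof (rule measurable_compose[where g = "\<lambda>(x, a). ?q x a"
        and f = "\<lambda>\<omega>. (fst \<omega>, act (snd \<omega>))", simplified])
    show "(\<lambda>\<omega>. (fst \<omega>, act (snd \<omega>))) \<in> F \<rightarrow>\<^sub>M N \<Otimes>\<^sub>M count_space UNIV"
      unfolding F_def by (rule measurable_vimage_algebra1) (auto simp: space_pair_measure)
    \<comment> \<open>With \<open>of_bool\<close> weights the index set no longer varies with the
      action, so measurability can be checked term by term.\<close>
    have "(\<lambda>\<omega>. (\<Sum>d\<in>UNIV. of_bool (snd \<omega> = act d) * (u (fst \<omega>) d * v d)) /
        (\<Sum>d\<in>UNIV. of_bool (snd \<omega> = act d) * u (fst \<omega>) d)) \<in> borel_measurable (N \<Otimes>\<^sub>M count_space UNIV)"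
      by measurable
    then show "(\<lambda>(x, a). ?q x a) \<in> borel_measurable (N \<Otimes>\<^sub>M count_space UNIV)"
      by (simp add: case_prod_beta of_bool_def if_distrib[of "\<lambda>c. c * _"] sum.If_cases eq_commute
          cong: if_cong)
  qed
  have qM: "(\<lambda>\<omega>. ?q (fst \<omega>) (act (snd \<omega>))) \<in> borel_measurable M"
    by (rule measurable_from_subalg[OF sub q])
  \<comment> \<open>The quotient is a weighted average of values of \<open>v\<close>, or 0 when the
    weights vanish; either way it is bounded, hence integrable under a probability measure.\<close>
  have q_bound: "norm (?q x a) \<le> (\<Sum>d\<in>UNIV. \<bar>v d\<bar>)" for x a
  proof -
    have v: "\<bar>v d\<bar> \<le> (\<Sum>d\<in>UNIV. \<bar>v d\<bar>)" for d
      by (rule member_le_sum) auto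
    have "\<bar>\<Sum>d | act d = a. u x d * v d\<bar> \<le> (\<Sum>d | act d = a. u x d * (\<Sum>d\<in>UNIV. \<bar>v d\<bar>))"
      using u(2) v by (intro order.trans[OF sum_abs] sum_mono) (auto simp: abs_mult intro!: mult_left_mono)
    moreover have "0 \<le> (\<Sum>d | act d = a. u x d)" by (intro sum_nonneg u)
    ultimately show ?thesis
      by (cases "(\<Sum>d | act d = a. u x d) = 0")
        (auto simp: divide_simps mult.commute sum_distrib_left[symmetric] sum_distrib_right[symmetric] intro: sum_nonneg)
  qed
  have int_v: "integrable M (\<lambda>\<omega>. v (snd \<omega>))"
    by (rule integrable_const_bound[of _ "\<Sum>d\<in>UNIV. \<bar>v d\<bar>"]) (auto intro!: member_le_sum)
  have int_q: "integrable M (\<lambda>\<omega>. ?q (fst \<omega>) (act (snd \<omega>)))"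
    by (rule integrable_const_bound[OF _ qM]) (use q_bound in blast)
  show "AE \<omega> in M. real_cond_exp M F (\<lambda>\<omega>. v (snd \<omega>)) \<omega> = ?q (fst \<omega>) (act (snd \<omega>))"
  proof (rule real_cond_exp_charact[OF _ int_v int_q q])
    fix A assume A: "A \<in> sets F"
    then have AM: "A \<in> sets M" using sub by (auto simp: subalgebra_def)
    obtain B where B: "A = (\<lambda>\<omega>. (fst \<omega>, act (snd \<omega>))) -` B \<inter> (space N \<times> UNIV)"
      using A unfolding sets_F by blast
    have ind: "indicator A (x, d) = (indicator B (x, act d) :: real)" if "x \<in> space N" for x d
      using that by (auto simp: B indicator_def)
    have *: "(\<integral>\<omega>\<in>A. w \<omega> \<partial>M) = (\<integral>x. (\<Sum>d\<in>UNIV. u x d * (indicator B (x, act d) * w (x, d))) \<partial>N)"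
      if w: "integrable M w" for w :: "_ \<Rightarrow> real"
    proof -
      have "integrable M (\<lambda>\<omega>. indicator A \<omega> *\<^sub>R w \<omega>)"
        by (rule integrable_mult_indicator[OF AM w])
      then have "(\<integral>\<omega>\<in>A. w \<omega> \<partial>M) = (\<integral>x. (\<Sum>d\<in>UNIV. u x d * (indicator A (x, d) *\<^sub>R w (x, d))) \<partial>N)"
        unfolding set_lebesgue_integral_def M_def
        by (intro integral_density_count_space assms(3) u) 
      also have "\<dots> = (\<integral>x. (\<Sum>d\<in>UNIV. u x d * (indicator B (x, act d) * w (x, d))) \<partial>N)"
        by (intro Bochner_Integration.integral_cong sum.cong) (auto simp: ind)
      finally show ?thesis .
    qed
    \<comment> \<open>The two integrands over \<open>N\<close> agree at each \<open>x\<close>: on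
      the draws sharing an action, the indicator and the quotient are constant, so the sums are
      compared action by action.\<close>
    have "(\<Sum>d\<in>UNIV. u x d * (indicator B (x, act d) * v d))
        = (\<Sum>d\<in>UNIV. u x d * (indicator B (x, act d) * ?q x (act d)))" for x
    proof -
      have "(\<Sum>d | act d = a. u x d * (indicator B (x, act d) * v d))
          = (\<Sum>d | act d = a. u x d * (indicator B (x, act d) * ?q x (act d)))" for a
      proof -
        \<comment> \<open>Nonnegative weights with sum 0 all vanish, so the numerator is 0 as well
          and the default value of division by 0 does no harm.\<close>
        have zero: "(\<Sum>d | act d = a. u x d * v d) = 0" if "(\<Sum>d | act d = a. u x d) = 0"
          using that u(2) by (subst (asm) sum_nonneg_eq_0_iff) auto
        have "(\<Sum>d | act d = a. u x d * (indicator B (x, act d) * v d))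
            = indicator B (x, a) * (\<Sum>d | act d = a. u x d * v d)"
          unfolding sum_distrib_left by (rule sum.cong) auto
        also have "\<dots> = (\<Sum>d | act d = a. u x d) * (indicator B (x, a) * ?q x a)"
          using zero by auto
        also have "\<dots> = (\<Sum>d | act d = a. u x d * (indicator B (x, act d) * ?q x (act d)))"
          unfolding sum_distrib_right by (rule sum.cong) auto
        finally show ?thesis .
      qed
      then have "(\<Sum>a\<in>range act. \<Sum>d | act d = a. u x d * (indicator B (x, act d) * v d))
          = (\<Sum>a\<in>range act. \<Sum>d | act d = a. u x d * (indicator B (x, act d) * ?q x (act d)))"
        by (rule sum.cong[OF refl])
      moreover have "(\<Sum>a\<in>range act. sum k {d. act d = a}) = sum k UNIV" for k :: "'d \<Rightarrow> real"
        using sum.group[of "UNIV :: 'd set" "range act" act k] by simp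
      ultimately show ?thesis by (simp only:)
    qed
    then show "(\<integral>\<omega>\<in>A. v (snd \<omega>) \<partial>M) = (\<integral>\<omega>\<in>A. ?q (fst \<omega>) (act (snd \<omega>)) \<partial>M)"
      by (simp only: *[OF int_v] *[OF int_q] fst_conv snd_conv)
  qed
qed

section \<open>Explicit probabilities of a draw\<close>

lemma pmf_bind_bool:
  fixes b :: "bool pmf"
  shows "pmf (b \<bind> k) x = pmf b True * pmf (k True) x + pmf b False * pmf (k False) x"
  by (simp add: pmf_bind integral_measure_pmf[of UNIV] UNIV_bool)

text \<open>The factors stay as values of \<open>bernoulli_pmf\<close>, so this is an identity in
  arbitrary real parameters; bounds enter only when the factors are evaluated.\<close>

lemma pmf_draw_pmf:
  "pmf (draw_pmf p \<alpha> g h\<^sub>I h\<^sub>N \<eta>) (high, active, informed, sells, owns) =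
     pmf (bernoulli_pmf p) high * pmf (bernoulli_pmf g) active * pmf (bernoulli_pmf \<alpha>) informed *
     (if informed then of_bool (sells \<noteq> high) else pmf (bernoulli_pmf \<eta>) sells) *
     pmf (bernoulli_pmf (if informed then h\<^sub>I else h\<^sub>N)) owns"
  unfolding draw_pmf_def pmf_bind_bool bind_return_pmf if_True if_False
  by (cases high; cases active; cases informed; cases sells; cases owns)
    (simp_all add: indicator_def)

lemma borel_measurable_pmf_draw_pmf [measurable]:
  "(\<lambda>\<eta>. pmf (draw_pmf p \<alpha> g h\<^sub>I h\<^sub>N \<eta>) d) \<in> borel_measurable borel"
proof -
  \<comment> \<open>\<open>bernoulli_pmf\<close> truncates its parameter to the unit interval by
    \<open>min\<close> and \<open>max\<close>, hence measurability on the whole line.\<close>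
  have [measurable]: "(\<lambda>\<eta>. pmf (bernoulli_pmf \<eta>) b) \<in> borel_measurable borel" for b
    by (simp add: bernoulli_pmf.rep_eq)
  obtain high active informed sells owns where d: "d = (high, active, informed, sells, owns)"
    by (cases d)
  show ?thesis unfolding d pmf_draw_pmf by (cases informed) simp_all
qed

lemma sum_UNIV_draw:
  fixes F :: "draw \<Rightarrow> 'a::comm_monoid_add"
  shows "sum F UNIV = (\<Sum>high\<in>UNIV. \<Sum>active\<in>UNIV. \<Sum>informed\<in>UNIV. \<Sum>sells\<in>UNIV. \<Sum>owns\<in>UNIV.
    F (high, active, informed, sells, owns))"
  by (simp add: sum.cartesian_product flip: UNIV_Times_UNIV)

section \<open>The law of the economy and the weights of the actions given \<eta>\<close>

locale short_sale_economy =
  fixes p \<alpha> g h\<^sub>I h\<^sub>N :: real and f :: "real \<Rightarrow> real"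
  assumes p: "0 < p" "p < 1" and \<alpha>: "0 < \<alpha>" "\<alpha> < 1" and g: "0 < g" "g < 1"
    and h\<^sub>I: "0 < h\<^sub>I" "h\<^sub>I < 1" and h\<^sub>N: "0 < h\<^sub>N" "h\<^sub>N \<le> 1"
    and f: "f \<in> borel_measurable borel" "\<And>x. 0 \<le> f x" "\<And>x. x \<notin> {0..1} \<Longrightarrow> f x = 0"
      "(\<integral>\<^sup>+x. ennreal (f x) \<partial>lborel) = 1"
begin

abbreviation "M \<equiv> economy p \<alpha> g h\<^sub>I h\<^sub>N f"

definition action_prob :: "bool \<Rightarrow> real \<Rightarrow> action \<Rightarrow> real" where
  "action_prob ban \<eta> a =
    (\<Sum>d | observed_action ban (\<eta>, d) = a. pmf (draw_pmf p \<alpha> g h\<^sub>I h\<^sub>N \<eta>) d)"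

text \<open>Not normalised: this is the expectation of the asset value restricted to the event of
  the action, so that its quotient by \<open>action_prob\<close> is the Bayes price.\<close>

definition action_value :: "bool \<Rightarrow> real \<Rightarrow> action \<Rightarrow> real" where
  "action_value ban \<eta> a =
    (\<Sum>d | observed_action ban (\<eta>, d) = a. pmf (draw_pmf p \<alpha> g h\<^sub>I h\<^sub>N \<eta>) d * asset_value (\<eta>, d))"

text \<open>Given \<eta>, each difference is the covariance of the asset value with the indicator of
  the action, that is, \<open>p * (1 - p)\<close> times the probability of the action when the value
  is 1 minus that when it is 0. Noise traders contribute equally to both and cancel. The sign tells
  on which side of \<open>p\<close> the price lies.\<close>

lemma action_surplus:
  assumes \<eta>: "0 \<le> \<eta>" "\<eta> \<le> 1"
  shows "action_value ban \<eta> Buy - p * action_prob ban \<eta> Buy = p * (1 - p) * g * \<alpha>"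
    and "action_value False \<eta> No_Trade - p * action_prob False \<eta> No_Trade = 0"
    and "action_value True \<eta> No_Trade - p * action_prob True \<eta> No_Trade
      = - (p * (1 - p) * g * \<alpha> * (1 - h\<^sub>I))"
    and "action_value True \<eta> Sell - p * action_prob True \<eta> Sell = - (p * (1 - p) * g * \<alpha> * h\<^sub>I)"
proof -
  \<comment> \<open>Sums over all draws can be expanded into explicit terms by
    \<open>sum_UNIV_draw\<close>.\<close>
  have *: "(\<Sum>d | P d. F d) = (\<Sum>d\<in>UNIV. if P d then F d else 0)" for P and F :: "draw \<Rightarrow> real"
    by (simp add: sum.If_cases)
  note simps = action_value_def action_prob_def * sum_UNIV_draw UNIV_bool pmf_draw_pmf
  show "action_value ban \<eta> Buy - p * action_prob ban \<eta> Buy = p * (1 - p) * g * \<alpha>"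
    using p \<alpha> g h\<^sub>I h\<^sub>N \<eta> by (simp add: simps) (simp add: algebra_simps)
  show "action_value False \<eta> No_Trade - p * action_prob False \<eta> No_Trade = 0"
    using p \<alpha> g h\<^sub>I h\<^sub>N \<eta> by (simp add: simps) (simp add: algebra_simps)
  show "action_value True \<eta> No_Trade - p * action_prob True \<eta> No_Trade
      = - (p * (1 - p) * g * \<alpha> * (1 - h\<^sub>I))"
    using p \<alpha> g h\<^sub>I h\<^sub>N \<eta> by (simp add: simps) (simp add: algebra_simps)
  show "action_value True \<eta> Sell - p * action_prob True \<eta> Sell = - (p * (1 - p) * g * \<alpha> * h\<^sub>I)"
    using p \<alpha> g h\<^sub>I h\<^sub>N \<eta> by (simp add: simps) (simp add: algebra_simps)
qed

lemma space_economy: "space M = UNIV"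
  by (simp add: economy_def space_pair_measure)

lemma sets_economy [measurable_cong]: "sets M = sets (borel \<Otimes>\<^sub>M count_space UNIV)"
  unfolding economy_def sets_density by (rule sets_pair_measure_cong) simp_all

lemma emeasure_economy:
  "emeasure M (UNIV \<times> D) = (\<integral>\<^sup>+\<eta>. ennreal (f \<eta> * measure_pmf.prob (draw_pmf p \<alpha> g h\<^sub>I h\<^sub>N \<eta>) D) \<partial>lborel)"
  using emeasure_density_count_space[of "\<lambda>\<eta> d. f \<eta> * pmf (draw_pmf p \<alpha> g h\<^sub>I h\<^sub>N \<eta>) d" lborel D] f
  by (simp add: economy_def space_pair_measure measure_measure_pmf_finite sum_distrib_left)

lemma prob_space_economy: "prob_space M"
  using emeasure_economy[of UNIV] f(4) by (intro prob_spaceI) (simp add: space_economy)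

text \<open>The active component has the same Bernoulli law for every \<eta>, so integrating against
  \<open>f\<close> leaves \<open>g\<close>.\<close>

lemma prob_active: "\<P>(\<omega> in M. fst (snd (snd \<omega>))) = g"
proof -
  have "measure_pmf.prob (draw_pmf p \<alpha> g h\<^sub>I h\<^sub>N \<eta>) {d. fst (snd d)} = g" for \<eta>
  proof -
    have "measure_pmf.prob (draw_pmf p \<alpha> g h\<^sub>I h\<^sub>N \<eta>) {d. fst (snd d)}
      = measure_pmf.prob (map_pmf (\<lambda>d. fst (snd d)) (draw_pmf p \<alpha> g h\<^sub>I h\<^sub>N \<eta>)) {True}"
      by (simp add: vimage_def)
    also have "map_pmf (\<lambda>d. fst (snd d)) (draw_pmf p \<alpha> g h\<^sub>I h\<^sub>N \<eta>) = bernoulli_pmf g"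
      by (simp add: draw_pmf_def map_bind_pmf bind_return_pmf')
    finally show ?thesis using g by (simp add: measure_pmf_single)
  qed
  moreover have "{\<omega> \<in> space M. fst (snd (snd \<omega>))} = UNIV \<times> {d. fst (snd d)}"
    by (auto simp: space_economy)
  ultimately show ?thesis
    using g f by (simp add: measure_def emeasure_economy ennreal_mult' nn_integral_multc)
qed

section \<open>Prices as Bayes quotients\<close>

text \<open>Makes the action a function of the draw alone, with 0 as a placeholder, as the general
  conditional expectation formula demands.\<close>

lemma observed_action_fst: "observed_action ban (\<eta>, d) = observed_action ban (0, d)"
  by (cases d) simp

lemma measurable_observed_action [measurable]:
  "observed_action ban \<in> M \<rightarrow>\<^sub>M count_space UNIV"
proof -
  have "(\<lambda>\<omega>. observed_action ban (0, snd \<omega>)) \<in> M \<rightarrow>\<^sub>M count_space UNIV"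
    by measurable
  also have "(\<lambda>\<omega>. observed_action ban (0, snd \<omega>)) = observed_action ban"
    by (metis ext observed_action_fst prod.collapse)
  finally show ?thesis .
qed

lemma asset_value_eq: "asset_value = (\<lambda>\<omega>. of_bool (fst (snd \<omega>)))"
  by (auto simp: fun_eq_iff)

lemma market_info_eq:
  "market_info ban = vimage_algebra (space lborel \<times> UNIV)
     (\<lambda>\<omega>. (fst \<omega>, observed_action ban (0, snd \<omega>))) (lborel \<Otimes>\<^sub>M count_space UNIV)"
  unfolding market_info_def
  by (intro vimage_algebra_cong sets_pair_measure_cong) (auto intro: observed_action_fst)

lemma sigma_finite_subalgebra_market_info: "sigma_finite_subalgebra M (market_info ban)"
  unfolding market_info_eq economy_def
  by (rule real_cond_exp_density_count_space(1))
    (use f prob_space_economy in \<open>auto simp: economy_def lborel.sigma_finite_measure_axioms\<close>)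

text \<open>In the general formula the factor \<open>f \<eta>\<close> occurs in numerator and
  denominator and cancels where it is positive.\<close>

lemma AE_price_economy:
  "AE (\<eta>, d) in M. \<eta> \<in> {0..1} \<and> 0 < action_prob ban \<eta> (observed_action ban (\<eta>, d)) \<and>
     price M ban (\<eta>, d) = action_value ban \<eta> (observed_action ban (\<eta>, d)) /
       action_prob ban \<eta> (observed_action ban (\<eta>, d))"
proof -
  let ?u = "\<lambda>\<eta> d. f \<eta> * pmf (draw_pmf p \<alpha> g h\<^sub>I h\<^sub>N \<eta>) d"
  have u: "(\<lambda>\<eta>. ?u \<eta> d) \<in> borel_measurable lborel" for d
    using f(1) by simp
  have "AE \<omega> in M. price M ban \<omega> =
      (\<Sum>d | observed_action ban (0, d) = observed_action ban (0, snd \<omega>). ?u (fst \<omega>) d * of_bool (fst d)) /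
      (\<Sum>d | observed_action ban (0, d) = observed_action ban (0, snd \<omega>). ?u (fst \<omega>) d)"
    unfolding price_def asset_value_eq market_info_eq economy_def
    by (rule real_cond_exp_density_count_space(2))
      (use f u prob_space_economy in \<open>auto simp: economy_def lborel.sigma_finite_measure_axioms\<close>)
  \<comment> \<open>A density is positive almost everywhere under the measure it defines. This gives
    \<open>f \<eta> > 0\<close>, hence \<eta> in the unit interval, and a positive probability for
    the action that occurred.\<close>
  moreover have "AE \<omega> in M. 0 < ?u (fst \<omega>) (snd \<omega>)"
    using measurable_pair_count_space_finite[of ?u, OF u]
    unfolding economy_def case_prod_beta by (subst AE_density) auto
  ultimately show ?thesis
  proof eventually_elim
    case (elim \<omega>)
    obtain \<eta> d where \<omega>: "\<omega> = (\<eta>, d)" by (cases \<omega>)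
    from elim(2) have u: "0 < f \<eta>" "0 < pmf (draw_pmf p \<alpha> g h\<^sub>I h\<^sub>N \<eta>) d"
      using f(2)[of \<eta>] by (auto simp: \<omega> zero_less_mult_iff)
    have "\<eta> \<in> {0..1}" using f(3)[of \<eta>] u(1) by fastforce
    moreover have "0 < action_prob ban \<eta> (observed_action ban (\<eta>, d))"
      unfolding action_prob_def by (rule sum_pos2[of _ d]) (use u in auto)
    moreover have "price M ban \<omega> = action_value ban \<eta> (observed_action ban (\<eta>, d)) /
       action_prob ban \<eta> (observed_action ban (\<eta>, d))"
      using elim(1) u(1)
      by (simp add: \<omega> action_prob_def action_value_def observed_action_fst[of _ \<eta>] asset_value_eq
          mult.assoc flip: sum_distrib_left)
    ultimately show ?case by (simp add: \<omega>)
  qed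
qed

section \<open>Position of the prices relative to \<open>p\<close>\<close>

text \<open>The surplus is positive for a buy order and zero for no trade, so neither can push the
  price below \<open>p\<close>.\<close>

lemma AE_price_less_imp_Sell:
  "AE \<omega> in M. price M False \<omega> < p \<longrightarrow> observed_action False \<omega> = Sell"
  using AE_price_economy[of False]
proof eventually_elim
  case (elim \<omega>)
  obtain \<eta> d where \<omega>: "\<omega> = (\<eta>, d)" by (cases \<omega>)
  have "0 < p * (1 - p) * g * \<alpha>" using p \<alpha> g by simp
  then show ?case
    using elim action_surplus(1)[of \<eta> False] action_surplus(2)[of \<eta>]
    by (cases "observed_action False \<omega>") (auto simp: \<omega> pos_divide_less_eq)
qed

text \<open>Both other surpluses are strictly negative: that of a sell order because
  \<open>h\<^sub>I > 0\<close>, that of no trade because \<open>h\<^sub>I < 1\<close>.\<close>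

lemma AE_price_ban_ge_imp_Buy:
  "AE \<omega> in M. p \<le> price M True \<omega> \<longrightarrow> observed_action True \<omega> = Buy"
  using AE_price_economy[of True]
proof eventually_elim
  case (elim \<omega>)
  obtain \<eta> d where \<omega>: "\<omega> = (\<eta>, d)" by (cases \<omega>)
  have "0 < p * (1 - p) * g * \<alpha> * h\<^sub>I" "0 < p * (1 - p) * g * \<alpha> * (1 - h\<^sub>I)"
    using p \<alpha> g h\<^sub>I by simp_all
  then show ?case
    using elim action_surplus(3,4)[of \<eta>]
    by (cases "observed_action True \<omega>") (auto simp: \<omega> pos_le_divide_eq)
qed

section \<open>Means, order probabilities and medians\<close>

lemma price_mean: "(\<integral>\<omega>. price M ban \<omega> \<partial>M) = (\<integral>\<omega>. asset_value \<omega> \<partial>M)"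
proof -
  interpret prob_space M by (rule prob_space_economy)
  interpret S: sigma_finite_subalgebra M "market_info ban"
    by (rule sigma_finite_subalgebra_market_info)
  have "asset_value \<in> borel_measurable M"
    unfolding asset_value_eq
    by (rule measurable_compose[of snd M "count_space UNIV" "\<lambda>d. of_bool (fst d)"]) simp_all
  then have "integrable M asset_value"
    by (intro integrable_const_bound[of _ 1]) (auto simp: asset_value_eq)
  then show ?thesis
    unfolding price_def by (rule S.real_cond_exp_int(2))
qed

lemma price_measurable [measurable]: "price M ban \<in> borel_measurable M"
  unfolding price_def by (rule borel_measurable_cond_exp2)

text \<open>Every order comes from an active trader, and activity has probability
  \<open>g\<close>.\<close>

lemma prob_order_less_half:
  assumes "g < 1 / 2" and a: "a \<noteq> No_Trade"
  shows "\<P>(\<omega> in M. observed_action ban \<omega> = a) < 1 / 2"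
proof -
  interpret prob_space M by (rule prob_space_economy)
  have "{\<omega> \<in> space M. fst (snd (snd \<omega>))} = UNIV \<times> {d. fst (snd d)}"
    by (auto simp: space_economy)
  then have "{\<omega> \<in> space M. fst (snd (snd \<omega>))} \<in> events"
    by (simp add: sets_economy)
  then have "\<P>(\<omega> in M. observed_action ban \<omega> = a) \<le> \<P>(\<omega> in M. fst (snd (snd \<omega>)))"
    using a by (intro finite_measure_mono) (auto split: if_splits)
  then show ?thesis using assms(1) prob_active by simp
qed

lemma median_ban_less:
  assumes "\<P>(\<omega> in M. observed_action False \<omega> = Buy) < 1 / 2"
    and m: "is_median M (price M True) m"
  shows "m < p"
proof (rule ccontr)
  interpret prob_space M by (rule prob_space_economy)
  assume "\<not> m < p"
  \<comment> \<open>A price of at least \<open>m\<close> is then at least \<open>p\<close>, which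
    almost surely happens only after a buy order.\<close>
  then have "\<P>(\<omega> in M. price M True \<omega> \<ge> m) \<le> \<P>(\<omega> in M. observed_action True \<omega> = Buy)"
    using AE_price_ban_ge_imp_Buy by (intro finite_measure_mono_AE) auto
  \<comment> \<open>The ban leaves the event of a buy order unchanged, so the bound assumed without
    a ban applies.\<close>
  also have "\<dots> = \<P>(\<omega> in M. observed_action False \<omega> = Buy)"
    by (rule arg_cong[where f = "measure M"]) (auto split: if_splits)
  finally show False using assms by (simp add: is_median_def)
qed

lemma median_ge:
  assumes "\<P>(\<omega> in M. observed_action False \<omega> = Sell) < 1 / 2"
    and m: "is_median M (price M False) m"
  shows "p \<le> m"
proof (rule ccontr)
  interpret prob_space M by (rule prob_space_economy)
  assume "\<not> p \<le> m"
  \<comment> \<open>A price of at most \<open>m\<close> is then strictly below \<open>p\<close>,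
    which almost surely requires a sell order.\<close>
  then have "\<P>(\<omega> in M. price M False \<omega> \<le> m) \<le> \<P>(\<omega> in M. observed_action False \<omega> = Sell)"
    using AE_price_less_imp_Sell by (intro finite_measure_mono_AE) auto
  then show False using assms by (simp add: is_median_def)
qed

end

theorem lemma4:
  fixes p \<alpha> g h\<^sub>I h\<^sub>N :: real and f :: "real \<Rightarrow> real"
  defines "M \<equiv> economy p \<alpha> g h\<^sub>I h\<^sub>N f"
  assumes "0 < p" "p < 1" "0 < \<alpha>" "\<alpha> < 1" "0 < g" "g < 1"
    and "0 < h\<^sub>I" "h\<^sub>I < 1" "0 < h\<^sub>N" "h\<^sub>N \<le> 1"
    and "f \<in> borel_measurable borel" "\<And>x. 0 \<le> f x" "\<And>x. x \<notin> {0..1} \<Longrightarrow> f x = 0"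
    and "(\<integral>\<^sup>+ x. ennreal (f x) \<partial>lborel) = 1"
  shows "(g < 1 / 2 \<longrightarrow>
            \<P>(\<omega> in M. observed_action False \<omega> = Buy) < 1 / 2 \<and>
            \<P>(\<omega> in M. observed_action False \<omega> = Sell) < 1 / 2) \<and>
         (\<P>(\<omega> in M. observed_action False \<omega> = Buy) < 1 / 2 \<and>
          \<P>(\<omega> in M. observed_action False \<omega> = Sell) < 1 / 2 \<longrightarrow>
            (\<integral>\<omega>. price M True \<omega> \<partial>M) = (\<integral>\<omega>. price M False \<omega> \<partial>M) \<and>
            (\<forall>m\<^sub>b m. is_median M (price M True) m\<^sub>b \<longrightarrow> is_median M (price M False) m \<longrightarrow> m\<^sub>b < m))"
proof -
  interpret short_sale_economy p \<alpha> g h\<^sub>I h\<^sub>N f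
    by unfold_locales (use assms in auto)
  show ?thesis
  proof (intro conjI impI allI)
    fix m\<^sub>b m
    assume "\<P>(\<omega> in M. observed_action False \<omega> = Buy) < 1 / 2 \<and>
      \<P>(\<omega> in M. observed_action False \<omega> = Sell) < 1 / 2"
      and "is_median M (price M True) m\<^sub>b" "is_median M (price M False) m"
    \<comment> \<open>The prior mean \<open>p\<close> separates the medians:
      \<open>m\<^sub>b < p\<close> and \<open>p \<le> m\<close>.\<close>
    then show "m\<^sub>b < m"
      unfolding M_def using median_ban_less[of m\<^sub>b] median_ge[of m] by linarith
  \<comment> \<open>What remains are the two order bounds under \<open>g < 1 / 2\<close> and the
    equality of means, both sides of which become the mean of \<open>asset_value\<close>.\<close>
  qed (simp_all only: M_def prob_order_less_half price_mean action.distinct not_False_eq_True)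
qed

end
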